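(* Let $\lambda\ge 0$ and $\mu_1\in\mathbb{R}$ be real constants, let $n\ge 2$ be an integer, and let $h\in C^2((0,\infty))\cap C^1([0,\infty))$ satisfy $$2r^2h(r)h_{rr}(r)=(n-1)h(r)(h(r)-1)+rh_r(r)\big(rh_r(r)-\lambda r-(n-1)\big),\qquad h(r)>0,\qquad \forall r>0,$$ together with $h(0)=1$ and $h_r(0)=\mu_1$. Then: - if $\mu_1>0$, then $h(r)>1$ and $h_r(r)>0$ for all $r>0$; - if $\mu_1<0$, then $0<h(r)<1$ and $h_r(r)<0$ for all $r>0$.
   Context: Functions are real-valued; $h_r$ and $h_{rr}$ denote the first and second derivatives of $h$ in $r$. $C^1([0,\infty))$ means continuously differentiable up to $r=0$, with $h_r(0)$ the one-sided derivative at $0$. *)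

theory Defs
  imports "HOL-Analysis.Analysis"
begin

end

(* The function h_r keeps its initial sign: where h_r vanishes the equation reduces to
   2 r^2 h_rr = (n - 1) (h - 1), so at a first zero of h_r both h - 1 and h_rr carry the initial
   sign of h_r, and h_r would approach that zero from the wrong side. *)

theory Submission
  imports Defs
begin

text \<open>If positivity failed, there would be a least \<open>z\<close> with
  \<open>g z \<le> 0\<close>, and \<open>g\<close> would vanish there. A positive derivative at
  \<open>z\<close> makes \<open>g\<close> negative just to the left of \<open>z\<close>, where it is
  still positive by minimality.\<close>

lemma pos_if_deriv_pos_at_first_zero:
  fixes g g' :: "real \<Rightarrow> real"
  assumes cont: "continuous_on {0..} g" and "g 0 > 0"
    and deriv: "\<And>r. r > 0 \<Longrightarrow> (g has_real_derivative g' r) (at r)"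
    and first_zero: "\<And>r. \<lbrakk>r > 0; g r = 0; \<And>t. 0 \<le> t \<Longrightarrow> t < r \<Longrightarrow> g t > 0\<rbrakk> \<Longrightarrow> g' r > 0"
    and "r \<ge> 0"
  shows "g r > 0"
proof (rule ccontr)
  assume "\<not> g r > 0"
  define S where "S = {t \<in> {0..}. g t \<le> 0}"
  have "closed S"
    unfolding S_def using cont by (intro continuous_on_closed_Collect_le) auto
  moreover have "S \<noteq> {}" "bdd_below S"
    using \<open>\<not> g r > 0\<close> \<open>r \<ge> 0\<close> by (auto simp: S_def intro!: bdd_belowI[of _ 0])
  ultimately have "Inf S \<in> S"
    by (rule closed_contains_Inf[rotated 2])
  then obtain z where z: "z = Inf S" "z \<ge> 0" "g z \<le> 0"
    by (auto simp: S_def)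
  have before: "g t > 0" if "0 \<le> t" "t < z" for t
    using cInf_lower[OF _ \<open>bdd_below S\<close>, of t] that z(1) by (force simp: S_def)
  have "z > 0"
    using z \<open>g 0 > 0\<close> by (cases "z = 0") auto
  \<comment> \<open>So far only \<open>g z \<le> 0\<close> is known. The intermediate value theorem
    gives a zero in \<open>{0..z}\<close>, and positivity before \<open>z\<close> leaves only
    \<open>z\<close> itself.\<close>
  have "\<exists>t\<ge>0. t \<le> z \<and> g t = 0"
    using z \<open>g 0 > 0\<close> by (intro IVT2') (auto intro: continuous_on_subset[OF cont])
  then have "g z = 0"
    using before by (metis order_less_irrefl order_le_imp_less_or_eq)
  then have "g' z > 0"
    using first_zero \<open>z > 0\<close> before by blast
  then obtain d where d: "d > 0" "\<And>e. e > 0 \<Longrightarrow> e < d \<Longrightarrow> g (z - e) < g z"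
    using DERIV_pos_inc_left[OF deriv[OF \<open>z > 0\<close>]] by blast
  \<comment> \<open>Halving \<open>d\<close> gives \<open>e < d\<close>; the cap \<open>z\<close>
    keeps \<open>z - e\<close> nonnegative, so that \<open>before\<close> applies to it.\<close>
  define e where "e = min (d / 2) z"
  have "g (z - e) < 0" "g (z - e) > 0"
    using d \<open>z > 0\<close> \<open>g z = 0\<close> by (auto simp: e_def intro!: before)
  then show False by simp
qed

theorem theorem1p2:
  fixes lam \<mu>\<^sub>1 :: real and n :: nat and h h_r h_rr :: "real \<Rightarrow> real"
  assumes "lam \<ge> 0" and "n \<ge> 2"
    and "\<And>r. r \<ge> 0 \<Longrightarrow> (h has_real_derivative h_r r) (at r within {0..})"
    and "continuous_on {0..} h_r"
    and "\<And>r. r > 0 \<Longrightarrow> (h_r has_real_derivative h_rr r) (at r)"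
    and "continuous_on {0<..} h_rr"
    and "\<And>r. r > 0 \<Longrightarrow> 2 * r\<^sup>2 * h r * h_rr r =
           (real n - 1) * h r * (h r - 1) + r * h_r r * (r * h_r r - lam * r - (real n - 1))"
    and "\<And>r. r > 0 \<Longrightarrow> h r > 0"
    and "h 0 = 1" and "h_r 0 = \<mu>\<^sub>1"
  shows "(\<mu>\<^sub>1 > 0 \<longrightarrow> (\<forall>r>0. h r > 1 \<and> h_r r > 0)) \<and>
         (\<mu>\<^sub>1 < 0 \<longrightarrow> (\<forall>r>0. 0 < h r \<and> h r < 1 \<and> h_r r < 0))"
proof -
  \<comment> \<open>The factor \<open>s\<close> treats both signs of \<open>\<mu>\<^sub>1\<close> at
    once; it is taken to be 1 or -1 at the end.\<close>
  have sign_preserved: "s * h_r r > 0 \<and> s * (h r - 1) > 0"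
    if "s * \<mu>\<^sub>1 > 0" "r > 0" for s r :: real
  proof -
    \<comment> \<open>The sign of \<open>h_r\<close> is required only strictly before
      \<open>t\<close>, so this also applies when \<open>t\<close> is a first zero of
      \<open>h_r\<close>. The reason is that \<open>s * h\<close> increases strictly from its value
      \<open>s\<close> at 0.\<close>
    have gap: "s * (h t - 1) > 0" if "t > 0" and pos: "\<And>u. 0 < u \<Longrightarrow> u < t \<Longrightarrow> s * h_r u > 0" for t
    proof -
      have "continuous_on {0..} h"
        using assms(3) by (intro DERIV_continuous_on) auto
      then have "continuous_on {0..t} (\<lambda>u. s * h u)"
        by (intro continuous_intros) (auto intro: continuous_on_subset)
      moreover have "((\<lambda>u. s * h u) has_real_derivative s * h_r u) (at u)" if "0 < u" for u
      proof -
        have "(h has_real_derivative h_r u) (at u within {0<..})"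
          using assms(3)[of u] that by (auto intro: DERIV_subset)
        then have "(h has_real_derivative h_r u) (at u)"
          using that by (simp add: at_within_open[of u "{0<..}"])
        then show ?thesis
          by (rule DERIV_cmult)
      qed
      ultimately have "s * h 0 < s * h t"
        using pos by (intro DERIV_pos_imp_increasing_open[OF \<open>t > 0\<close>]) blast+
      then show ?thesis
        using \<open>h 0 = 1\<close> by (simp add: algebra_simps)
    qed
    have "s * h_rr t > 0"
      if "t > 0" "s * h_r t = 0" "\<And>u. 0 \<le> u \<Longrightarrow> u < t \<Longrightarrow> s * h_r u > 0" for t
    proof -
      have "s \<noteq> 0"
        using \<open>s * \<mu>\<^sub>1 > 0\<close> by auto
      \<comment> \<open>Since \<open>s\<close> is nonzero, \<open>h_r t = 0\<close>, which removes
        the whole term containing \<open>lam\<close>; what remains has the positive factor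
        \<open>h t\<close> on both sides.\<close>
      then have "h t * (2 * t\<^sup>2 * h_rr t) = h t * ((real n - 1) * (h t - 1))"
        using assms(7)[OF \<open>t > 0\<close>] that by (simp add: algebra_simps)
      then have "2 * t\<^sup>2 * h_rr t = (real n - 1) * (h t - 1)"
        using assms(8)[OF \<open>t > 0\<close>] by (metis less_irrefl mult_left_cancel)
      then have "2 * t\<^sup>2 * (s * h_rr t) = (real n - 1) * (s * (h t - 1))"
        by (metis mult.left_commute)
      \<comment> \<open>Here \<open>n \<ge> 2\<close> makes the coefficient
        \<open>real n - 1\<close> strictly positive.\<close>
      moreover have "(real n - 1) * (s * (h t - 1)) > 0"
        using gap[OF \<open>t > 0\<close>] that(3) \<open>n \<ge> 2\<close> by (intro mult_pos_pos[of "real n - 1"]) simp_all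
      ultimately show ?thesis
        using \<open>t > 0\<close> by (metis zero_less_mult_pos zero_less_power mult_pos_pos zero_less_numeral)
    qed
    moreover have "continuous_on {0..} (\<lambda>t. s * h_r t)"
      using assms(4) by (intro continuous_intros)
    moreover have "((\<lambda>t. s * h_r t) has_real_derivative s * h_rr t) (at t)" if "t > 0" for t
      using assms(5)[OF that] by (rule DERIV_cmult)
    ultimately have "s * h_r t > 0" if "t \<ge> 0" for t
      using that \<open>s * \<mu>\<^sub>1 > 0\<close> \<open>h_r 0 = \<mu>\<^sub>1\<close>
        pos_if_deriv_pos_at_first_zero[of "\<lambda>t. s * h_r t" "\<lambda>t. s * h_rr t" t] by blast
    with gap \<open>r > 0\<close> show ?thesis by simp
  qed
  show ?thesis
    using sign_preserved[of 1] sign_preserved[of "- 1"] assms(8) by simp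
qed

end
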